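(* Let $G$ be a graph on $n$ vertices that has a $2$-factor. Then $c_G(\mathfrak m)=n$.
   Context: Let $G$ be a finite simple graph on the vertex set $[n]=\{1,\dots,n\}$, let $K$ be a field, $S=K[x_1,\dots,x_n,y_1,\dots,y_n]$ and $\mathfrak m=(x_1,\dots,x_n,y_1,\dots,y_n)$. The binomial edge ideal of $G$ is $J_G=(x_iy_j-x_jy_i : \{i,j\}\in E(G))\subset S$. For a positive integer $k$ put $\mathfrak m^{[k]}=(x_1^k,\dots,x_n^k,y_1^k,\dots,y_n^k)$, $(\mathfrak m^{[k]},J_G)=\mathfrak m^{[k]}+J_G$, $v_G(k)=\max\{r\in\mathbb N : \mathfrak m^r\not\subseteq(\mathfrak m^{[k]},J_G)\}$, and $c_G(\mathfrak m)=\lim_{k\to\infty} v_G(k)/k$ (the diagonal $F$-threshold of $S/J_G$). $G$ has a $2$-factor if there are pairwise vertex-disjoint cycles (each on at least $3$ vertices) in $G$ whose vertex sets together cover $V(G)$; the cycles are subgraphs of $G$, not necessarily induced. *)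

theory Defs
  imports
    "HOL-Analysis.Analysis"
    "HOL-Algebra.Ideal_Product"
    "HOL-Library.Poly_Mapping"
begin

definition simple_graph :: "nat \<Rightarrow> nat set set \<Rightarrow> bool" where
  "simple_graph n E \<longleftrightarrow> E \<subseteq> {e. e \<subseteq> {1..n} \<and> card e = 2}"

definition is_cycle :: "nat set set \<Rightarrow> nat list \<Rightarrow> bool" where
  "is_cycle E c \<longleftrightarrow> length c \<ge> 3 \<and> distinct c \<and>
     (\<forall>i < length c. {c ! i, c ! (Suc i mod length c)} \<in> E)"

definition has_two_factor :: "nat \<Rightarrow> nat set set \<Rightarrow> bool" where
  "has_two_factor n E \<longleftrightarrow>
     (\<exists>C. (\<forall>c \<in> C. is_cycle E c) \<and>
          (\<forall>c \<in> C. \<forall>d \<in> C. c \<noteq> d \<longrightarrow> set c \<inter> set d = {}) \<and>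
          (\<Union>c \<in> C. set c) = {1..n})"

datatype indet = X nat | Y nat

text \<open>
  Polynomials in the countably many indeterminates \<open>X i\<close>, \<open>Y i\<close>: finitely supported functions
  from monomials (themselves finitely supported exponent vectors) to coefficients. The ring
  \<open>K[x\<^sub>1,\<dots>,x\<^sub>n,y\<^sub>1,\<dots>,y\<^sub>n]\<close> is cut out as the carrier of those polynomials in which only
  indeterminates with index in \<open>{1..n}\<close> occur; the field \<open>K\<close> is the type \<open>'a\<close>.
\<close>

type_synonym 'a xy_poly = "(indet \<Rightarrow>\<^sub>0 nat) \<Rightarrow>\<^sub>0 'a"

definition xy_ring :: "nat \<Rightarrow> 'a::field xy_poly ring" where
  "xy_ring n = \<lparr>carrier = {p. \<forall>t \<in> Poly_Mapping.keys p. Poly_Mapping.keys t \<subseteq> X ` {1..n} \<union> Y ` {1..n}},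
                mult = (*), one = 1, zero = 0, add = (+)\<rparr>"

lemma xy_ring_cring: "cring (xy_ring n :: 'a::field xy_poly ring)"
proof -
  let ?V = "X ` {1..n} \<union> Y ` {1..n}"
  define P where "P = {p::'a xy_poly. \<forall>t \<in> Poly_Mapping.keys p. Poly_Mapping.keys t \<subseteq> ?V}"
  have R: "xy_ring n = \<lparr>carrier = P, mult = (*), one = 1, zero = 0, add = (+)\<rparr>"
    by (simp add: xy_ring_def P_def)
  have add: "p + q \<in> P" if "p \<in> P" "q \<in> P" for p q
    using that Poly_Mapping.keys_add[of p q] unfolding P_def by blast
  have mul: "p * q \<in> P" if "p \<in> P" "q \<in> P" for p q
    unfolding P_def mem_Collect_eq
  proof
    fix t assume "t \<in> Poly_Mapping.keys (p * q)"
    then obtain a b where "a \<in> Poly_Mapping.keys p" "b \<in> Poly_Mapping.keys q" "t = a + b"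
      using keys_mult[of p q] by blast
    with that show "Poly_Mapping.keys t \<subseteq> ?V"
      using Poly_Mapping.keys_add[of a b] unfolding P_def by blast
  qed
  have neg: "- p \<in> P" if "p \<in> P" for p using that by (simp add: P_def)
  have z: "0 \<in> P" "1 \<in> P" by (simp_all add: P_def)
  show ?thesis unfolding R
  proof (rule cringI)
    show "abelian_group \<lparr>carrier = P, mult = (*), one = 1, zero = 0, add = (+)\<rparr>"
      by (rule abelian_groupI) (auto simp: add z add_ac intro: bexI[OF _ neg])
    show "comm_monoid \<lparr>carrier = P, mult = (*), one = 1, zero = 0, add = (+)\<rparr>"
      by (rule comm_monoidI) (auto simp: mul z mult_ac)
  qed (auto simp: distrib_right)
qed

definition var :: "indet \<Rightarrow> 'a::field xy_poly" where
  "var v = Poly_Mapping.single (Poly_Mapping.single v 1) 1"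

definition binomial_edge_ideal :: "nat \<Rightarrow> nat set set \<Rightarrow> 'a::field xy_poly set" where
  "binomial_edge_ideal n E = Idl\<^bsub>xy_ring n\<^esub>
     {var (X i) * var (Y j) - var (X j) * var (Y i) | i j. {i, j} \<in> E}"

definition max_ideal :: "nat \<Rightarrow> 'a::field xy_poly set" where
  "max_ideal n = Idl\<^bsub>xy_ring n\<^esub> {var v | v. v \<in> X ` {1..n} \<union> Y ` {1..n}}"

definition bracket_power :: "nat \<Rightarrow> nat \<Rightarrow> 'a::field xy_poly set" where
  "bracket_power n k = Idl\<^bsub>xy_ring n\<^esub> {var v ^ k | v. v \<in> X ` {1..n} \<union> Y ` {1..n}}"

text \<open>
  The powers of the ideal \<open>max_ideal n\<close> are taken in the semiring of ideals of \<open>xy_ring n\<close>, so the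
  zeroth power is the whole ring. For \<open>k \<ge> 1\<close> the set below is finite and nonempty; the value at
  \<open>k = 0\<close> is irrelevant.
\<close>

definition v_number :: "'a::field itself \<Rightarrow> nat \<Rightarrow> nat set set \<Rightarrow> nat \<Rightarrow> nat" where
  "v_number K n E k = Max {r. \<not> (max_ideal n :: 'a xy_poly set) [^]\<^bsub>ideals_set (xy_ring n)\<^esub> r
     \<subseteq> bracket_power n k <+>\<^bsub>xy_ring n\<^esub> binomial_edge_ideal n E}"

definition F_threshold :: "'a::field itself \<Rightarrow> nat \<Rightarrow> nat set set \<Rightarrow> real" where
  "F_threshold K n E = lim (\<lambda>k. real (v_number K n E k) / real k)"

end

theory Submission
  imports Defs
begin

text \<open>
  In fact \<open>v\<^sub>G(k) = n (k - 1)\<close> for all \<open>k \<ge> 1\<close>. Upper bound: let \<open>d\<^sub>i\<close> be the degree of a monomial in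
  \<open>x\<^sub>i, y\<^sub>i\<close>. If \<open>d\<^sub>i + d\<^sub>j > 2 (k - 1)\<close> for some edge \<open>{i, j}\<close>, then, up to symmetry, \<open>d\<^sub>i \<ge> k\<close> and the
  total exponent of \<open>x\<^sub>i, x\<^sub>j\<close> is at least \<open>k\<close>; replacing \<open>x\<^sub>j y\<^sub>i\<close> by \<open>x\<^sub>i y\<^sub>j\<close> repeatedly produces
  \<open>x\<^sub>i\<^sup>k\<close>. Hence a monomial outside the ideal satisfies \<open>d\<^sub>i + d\<^sub>j \<le> 2 (k - 1)\<close> on every edge, and
  summing over the edges of the \<open>2\<close>-factor, which meet every vertex twice, bounds its degree by
  \<open>n (k - 1)\<close>. Lower bound: the substitution \<open>x\<^sub>i, y\<^sub>i \<mapsto> z\<^sub>i\<close> annihilates \<open>J\<^sub>G\<close> and sends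
  \<open>\<Prod>\<^sub>i x\<^sub>i\<^bsup>k-1\<^esup>\<close> outside \<open>(z\<^sub>1\<^sup>k, \<dots>, z\<^sub>n\<^sup>k)\<close>.
\<close>

section \<open>Arithmetic and ideals of the polynomial ring\<close>

abbreviation indets :: "nat \<Rightarrow> indet set" where
  "indets n \<equiv> X ` {1..n} \<union> Y ` {1..n}"

abbreviation xy_monom :: "(indet \<Rightarrow>\<^sub>0 nat) \<Rightarrow> 'a::field xy_poly" where
  "xy_monom t \<equiv> Poly_Mapping.single t 1"

lemma xy_ring_ops [simp]:
  "x \<otimes>\<^bsub>xy_ring n\<^esub> y = x * y" "x \<oplus>\<^bsub>xy_ring n\<^esub> y = x + y"
  "\<one>\<^bsub>xy_ring n\<^esub> = 1" "\<zero>\<^bsub>xy_ring n\<^esub> = 0"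
  by (simp_all add: xy_ring_def)

lemma mem_xy_ring_iff:
  "p \<in> carrier (xy_ring n) \<longleftrightarrow> (\<forall>t \<in> Poly_Mapping.keys p. Poly_Mapping.keys t \<subseteq> indets n)"
  by (simp add: xy_ring_def)

lemma xy_ring_add_closed:
  "p \<in> carrier (xy_ring n) \<Longrightarrow> q \<in> carrier (xy_ring n) \<Longrightarrow> p + q \<in> carrier (xy_ring n)"
  using Poly_Mapping.keys_add[of p q] by (auto simp: mem_xy_ring_iff)

lemma xy_ring_mult_closed:
  "p \<in> carrier (xy_ring n) \<Longrightarrow> q \<in> carrier (xy_ring n) \<Longrightarrow> p * q \<in> carrier (xy_ring n)"
  using cring.cring_simprules(5)[OF xy_ring_cring] by fastforce

lemma xy_ring_diff_closed:
  "p \<in> carrier (xy_ring n) \<Longrightarrow> q \<in> carrier (xy_ring n) \<Longrightarrow> p - q \<in> carrier (xy_ring n)"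
  using keys_diff[of p q] by (auto simp: mem_xy_ring_iff)

lemma xy_ring_power_closed:
  "p \<in> carrier (xy_ring n) \<Longrightarrow> p ^ m \<in> carrier (xy_ring n)"
  by (induction m) (auto simp: xy_ring_mult_closed, simp add: mem_xy_ring_iff)

lemma xy_ring_single_closed:
  "Poly_Mapping.keys t \<subseteq> indets n \<Longrightarrow> Poly_Mapping.single t c \<in> carrier (xy_ring n)"
  by (auto simp: mem_xy_ring_iff)

lemma var_power: "(var v :: 'a::field xy_poly) ^ m = xy_monom (Poly_Mapping.single v m)"
  by (induction m) (simp_all add: var_def mult_single single_add[symmetric])

lemma var_closed: "v \<in> indets n \<Longrightarrow> (var v :: 'a::field xy_poly) \<in> carrier (xy_ring n)"
  unfolding var_def by (rule xy_ring_single_closed) auto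

lemma poly_mapping_eq_sum_single:
  "p = (\<Sum>t\<in>Poly_Mapping.keys p. Poly_Mapping.single t (Poly_Mapping.lookup p t))"
  by (rule poly_mapping_eqI)
    (auto simp: lookup_sum lookup_single when_def in_keys_iff sum.delta')

lemma
  assumes "ideal I (xy_ring n :: 'a::field xy_poly ring)"
  shows xy_ideal_add: "p \<in> I \<Longrightarrow> q \<in> I \<Longrightarrow> p + q \<in> I"
    and xy_ideal_mult: "p \<in> I \<Longrightarrow> q \<in> carrier (xy_ring n) \<Longrightarrow> q * p \<in> I"
    and xy_ideal_zero: "0 \<in> I"
  using additive_subgroup.a_closed[OF ideal.axioms(1)[OF assms]]
    ideal.I_l_closed[OF assms] additive_subgroup.zero_closed[OF ideal.axioms(1)[OF assms]]
  by auto

lemma xy_ideal_sum: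
  assumes "ideal I (xy_ring n :: 'a::field xy_poly ring)" "\<And>a. a \<in> A \<Longrightarrow> f a \<in> I"
  shows "sum f A \<in> I"
  using assms(2)
  by (induction A rule: infinite_finite_induct)
    (auto intro: xy_ideal_add[OF assms(1)] xy_ideal_zero[OF assms(1)])

text \<open>Every ring element is a finite sum of terms, so by additivity absorption need only be
  tested against single terms. Additive inverses then come from multiplication by the constant
  \<open>- 1\<close>.\<close>

lemma xy_idealI:
  fixes I :: "'a::field xy_poly set"
  assumes sub: "I \<subseteq> carrier (xy_ring n)" and zero: "0 \<in> I"
    and add: "\<And>p q. p \<in> I \<Longrightarrow> q \<in> I \<Longrightarrow> p + q \<in> I"
    and mult: "\<And>p s c. p \<in> I \<Longrightarrow> Poly_Mapping.keys s \<subseteq> indets n \<Longrightarrow> Poly_Mapping.single s c * p \<in> I"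
  shows "ideal I (xy_ring n)"
proof -
  interpret cring "xy_ring n :: 'a xy_poly ring" by (rule xy_ring_cring)
  have sum: "sum f A \<in> I" if "\<And>a. a \<in> A \<Longrightarrow> f a \<in> I" for f :: "(indet \<Rightarrow>\<^sub>0 nat) \<Rightarrow> _" and A
    using that by (induction A rule: infinite_finite_induct) (auto intro: add zero)
  have l: "q * p \<in> I" if "p \<in> I" "q \<in> carrier (xy_ring n)" for p q
  proof -
    have "q * p = (\<Sum>t\<in>Poly_Mapping.keys q. Poly_Mapping.single t (Poly_Mapping.lookup q t) * p)"
      by (subst poly_mapping_eq_sum_single[of q]) (rule sum_distrib_right)
    then show ?thesis
      using that mult by (auto intro!: sum simp: mem_xy_ring_iff)
  qed
  have one: "- 1 \<in> carrier (xy_ring n :: 'a xy_poly ring)"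
    by (simp add: mem_xy_ring_iff)
  have "subgroup I (add_monoid (xy_ring n))"
  proof (rule add.subgroupI)
    fix a assume a: "a \<in> I"
    have "\<ominus>\<^bsub>xy_ring n\<^esub> a = (-1) * a"
      using a sub l[OF a one] minus_equality[of "-a" a] by auto
    then show "\<ominus>\<^bsub>xy_ring n\<^esub> a \<in> I"
      using l[OF a one] by simp
  next
    show "I \<subseteq> carrier (xy_ring n)" by (rule sub)
    show "I \<noteq> {}" using zero by blast
    show "a \<oplus>\<^bsub>xy_ring n\<^esub> b \<in> I" if "a \<in> I" "b \<in> I" for a b
      using add[OF that] by simp
  qed
  then show ?thesis
    using l by (intro idealI ring_axioms) (simp_all, simp_all add: mult.commute)
qed

section \<open>Exchanging variables modulo an ideal\<close>

text \<open>Congruence modulo \<open>I\<close> respects products; the induction telescopes the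
  difference of powers.\<close>

lemma xy_ideal_power_diff:
  assumes I: "ideal I (xy_ring n :: 'a::field xy_poly ring)" and "p - q \<in> I"
    and "p \<in> carrier (xy_ring n)" "q \<in> carrier (xy_ring n)"
  shows "p ^ m - q ^ m \<in> I"
proof (induction m)
  case 0
  show ?case by (simp add: xy_ideal_zero[OF I])
next
  case (Suc m)
  have "p ^ Suc m - q ^ Suc m = p * (p ^ m - q ^ m) + q ^ m * (p - q)"
    by (simp add: algebra_simps)
  with Suc assms show ?case
    by (auto intro!: xy_ideal_add[OF I] xy_ideal_mult[OF I] xy_ring_power_closed)
qed

lemma keys_minus_nat_subset: "Poly_Mapping.keys (t - u) \<subseteq> Poly_Mapping.keys t"
  for t u :: "'b \<Rightarrow>\<^sub>0 nat"
  by (auto simp: in_keys_iff lookup_minus)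

lemma xy_ideal_monom_dvd:
  assumes I: "ideal I (xy_ring n :: 'a::field xy_poly ring)" and "xy_monom u \<in> I"
    and t: "Poly_Mapping.keys t \<subseteq> indets n"
    and le: "\<And>v. Poly_Mapping.lookup u v \<le> Poly_Mapping.lookup t v"
  shows "xy_monom t \<in> I"
proof -
  have "t = (t - u) + u"
    by (rule poly_mapping_eqI) (simp add: lookup_add lookup_minus le)
  then have "(xy_monom t :: 'a xy_poly) = xy_monom (t - u) * xy_monom u"
    by (metis mult_single mult_1)
  moreover have "Poly_Mapping.keys (t - u) \<subseteq> indets n"
    by (rule subset_trans[OF keys_minus_nat_subset t])
  ultimately show ?thesis
    using xy_ideal_mult[OF I assms(2)] xy_ring_single_closed by metis
qed

text \<open>If \<open>t\<close> has exponent \<open>k - m\<close> at \<open>p\<close>, trading \<open>(p' q)\<^sup>m\<close> for \<open>(p q')\<^sup>m\<close> raises the exponent of \<open>p\<close> to \<open>k\<close>.\<close>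

lemma monom_mem_by_exchange:
  assumes I: "ideal I (xy_ring n :: 'a::field xy_poly ring)"
    and pk: "var p ^ k \<in> I" and rel: "var p * var q' - var p' * var q \<in> I"
    and dist: "p \<noteq> q" "p \<noteq> p'" "q \<noteq> p'" and V: "{p, q, p', q'} \<subseteq> indets n"
    and t: "Poly_Mapping.keys t \<subseteq> indets n"
    and q: "k \<le> Poly_Mapping.lookup t p + Poly_Mapping.lookup t q"
    and p': "k \<le> Poly_Mapping.lookup t p + Poly_Mapping.lookup t p'"
  shows "xy_monom t \<in> I"
proof -
  define m where "m = k - Poly_Mapping.lookup t p"
  define s where "s = t - (Poly_Mapping.single p' m + Poly_Mapping.single q m)"
  define u where "u = s + (Poly_Mapping.single p m + Poly_Mapping.single q' m)"
  \<comment> \<open>Subtraction of exponents is truncated. The two bounds by \<open>k\<close> give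
    exponents of at least \<open>m\<close> at both \<open>q\<close> and \<open>p'\<close>, so
    nothing is lost and \<open>s\<close> is the true cofactor.\<close>
  have s: "t = s + (Poly_Mapping.single p' m + Poly_Mapping.single q m)"
    using q p' dist unfolding s_def m_def
    by (intro poly_mapping_eqI) (auto simp: lookup_add lookup_minus lookup_single when_def)
  have keys_s: "Poly_Mapping.keys s \<subseteq> indets n"
    unfolding s_def by (rule subset_trans[OF keys_minus_nat_subset t])
  then have keys_u: "Poly_Mapping.keys u \<subseteq> indets n"
    unfolding u_def using V
    by (intro subset_trans[OF Poly_Mapping.keys_add] Un_least) (simp_all add: keys_single)
  \<comment> \<open>The exponent of \<open>u\<close> at \<open>p\<close> is at least that of
    \<open>t\<close> plus \<open>m\<close>, hence at least \<open>k\<close>, so the monomial is a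
    multiple of \<open>var p ^ k\<close>.\<close>
  have "xy_monom u \<in> I"
    using dist
    by (intro xy_ideal_monom_dvd[OF I _ keys_u, of "Poly_Mapping.single p k"])
      (use pk in \<open>auto simp: var_power u_def s_def m_def lookup_add lookup_minus lookup_single when_def\<close>)
  moreover have "xy_monom s * ((var p * var q') ^ m - (var p' * var q) ^ m) \<in> I"
    using V
    by (intro xy_ideal_mult[OF I] xy_ideal_power_diff[OF I] rel xy_ring_single_closed[OF keys_s]
        xy_ring_mult_closed var_closed) auto
  moreover have "(xy_monom t :: 'a xy_poly) =
      xy_monom u + (-1) * (xy_monom s * ((var p * var q') ^ m - (var p' * var q) ^ m))"
    unfolding power_mult_distrib var_power
    by (subst s) (simp add: u_def mult_single right_diff_distrib)
  moreover have "- 1 \<in> carrier (xy_ring n :: 'a xy_poly ring)"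
    by (simp add: mem_xy_ring_iff)
  ultimately show ?thesis
    by (metis xy_ideal_add[OF I] xy_ideal_mult[OF I])
qed

section \<open>Multidegree of a monomial and the edge criterion for membership\<close>

text \<open>The multigrading that puts \<open>X i\<close> and \<open>Y i\<close> in the same degree,
  the i-th unit vector. Both terms of an edge binomial have equal multidegree.\<close>

definition mdeg :: "(indet \<Rightarrow>\<^sub>0 nat) \<Rightarrow> nat \<Rightarrow> nat" where
  "mdeg t i = Poly_Mapping.lookup t (X i) + Poly_Mapping.lookup t (Y i)"

lemma mdeg_add: "mdeg (s + t) i = mdeg s i + mdeg t i"
  by (simp add: mdeg_def lookup_add)

lemma mdeg_single:
  "mdeg (Poly_Mapping.single (X j) m) i = (if i = j then m else 0)"
  "mdeg (Poly_Mapping.single (Y j) m) i = (if i = j then m else 0)"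
  by (auto simp: mdeg_def lookup_single when_def)

lemma simple_graph_edge:
  assumes "simple_graph n E" "{i, j} \<in> E"
  shows "i \<in> {1..n}" "j \<in> {1..n}" "i \<noteq> j"
  using assms by (auto simp: simple_graph_def)

lemma edge_generators_closed:
  assumes "simple_graph n E"
  shows "{var (X i) * var (Y j) - var (X j) * var (Y i) | i j. {i, j} \<in> E}
      \<subseteq> carrier (xy_ring n :: 'a::field xy_poly ring)"
  using simple_graph_edge[OF assms]
  by (auto intro!: xy_ring_diff_closed xy_ring_mult_closed var_closed)

lemma bracket_generators_closed:
  "{var v ^ k | v. v \<in> indets n} \<subseteq> carrier (xy_ring n :: 'a::field xy_poly ring)"
  using xy_ring_power_closed var_closed by blast

abbreviation frob_edge_ideal :: "nat \<Rightarrow> nat set set \<Rightarrow> nat \<Rightarrow> 'a::field xy_poly set" where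
  "frob_edge_ideal n E k \<equiv> bracket_power n k <+>\<^bsub>xy_ring n\<^esub> binomial_edge_ideal n E"

lemma
  assumes "simple_graph n E"
  shows frob_edge_ideal: "ideal (frob_edge_ideal n E k :: 'a::field xy_poly set) (xy_ring n)"
    and var_power_mem_frob_edge_ideal:
      "v \<in> indets n \<Longrightarrow> var v ^ k \<in> (frob_edge_ideal n E k :: 'a xy_poly set)"
    and edge_binomial_mem_frob_edge_ideal:
      "{i, j} \<in> E \<Longrightarrow> var (X i) * var (Y j) - var (X j) * var (Y i)
        \<in> (frob_edge_ideal n E k :: 'a xy_poly set)"
proof -
  let ?I = "frob_edge_ideal n E k :: 'a xy_poly set"
  interpret cring "xy_ring n :: 'a xy_poly ring" by (rule xy_ring_cring)
  have B: "ideal (bracket_power n k :: 'a xy_poly set) (xy_ring n)"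
    unfolding bracket_power_def by (rule genideal_ideal[OF bracket_generators_closed])
  have J: "ideal (binomial_edge_ideal n E :: 'a xy_poly set) (xy_ring n)"
    unfolding binomial_edge_ideal_def by (rule genideal_ideal[OF edge_generators_closed[OF assms]])
  show "ideal ?I (xy_ring n)" by (rule add_ideals[OF B J])
  have sum: "p + q \<in> ?I" if "p \<in> bracket_power n k" "q \<in> binomial_edge_ideal n E" for p q
    using that by (auto simp: set_add_def')
  show "var v ^ k \<in> ?I" if v: "v \<in> indets n"
  proof -
    have "(var v :: 'a xy_poly) ^ k \<in> bracket_power n k"
      unfolding bracket_power_def using v
      by (intro subsetD[OF genideal_self[OF bracket_generators_closed]]) blast
    from sum[OF this xy_ideal_zero[OF J]] show ?thesis by simp
  qed
  show "var (X i) * var (Y j) - var (X j) * var (Y i) \<in> ?I" if e: "{i, j} \<in> E"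
  proof -
    have "(var (X i) * var (Y j) - var (X j) * var (Y i) :: 'a xy_poly) \<in> binomial_edge_ideal n E"
      unfolding binomial_edge_ideal_def using e
      by (intro subsetD[OF genideal_self[OF edge_generators_closed[OF assms]]]) blast
    from sum[OF xy_ideal_zero[OF B] this] show ?thesis by simp
  qed
qed

text \<open>An instance of \<open>monom_mem_by_exchange\<close>: the pair with the same index gives
  the bound from \<open>mdeg t i\<close>, and the pair with the same letter gives the other
  bound.\<close>

lemma edge_monom_mem:
  assumes G: "simple_graph n E" and e: "{i, j} \<in> E"
    and t: "Poly_Mapping.keys t \<subseteq> indets n" and d: "2 * (k - 1) < mdeg t i + mdeg t j"
  shows "xy_monom t \<in> (frob_edge_ideal n E k :: 'a::field xy_poly set)"
    (is "_ \<in> ?I")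
proof -
  note I = frob_edge_ideal[OF G, of k, where ?'a='a]
  note v = var_power_mem_frob_edge_ideal[OF G, where k=k and ?'a='a]
  note rel = edge_binomial_mem_frob_edge_ideal[OF G, where k=k and ?'a='a]
  \<comment> \<open>The edge is oriented so that \<open>i\<close> carries degree at least
    \<open>k\<close>; the other orientation follows by swapping the ends.\<close>
  have main: "xy_monom t \<in> ?I" if e: "{i, j} \<in> E" and "k \<le> mdeg t i" "2 * (k - 1) < mdeg t i + mdeg t j"
    for i j
  proof -
    \<comment> \<open>The degree sum of the two ends is also the total exponent of the X-pair plus
      that of the Y-pair. It exceeds \<open>2 * (k - 1)\<close>, so one of these totals reaches
      \<open>k\<close>.\<close>
    have e': "{j, i} \<in> E" using e by (simp add: insert_commute)
    note ij = simple_graph_edge[OF G e]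
    have "k \<le> Poly_Mapping.lookup t (X i) + Poly_Mapping.lookup t (X j) \<or>
        k \<le> Poly_Mapping.lookup t (Y i) + Poly_Mapping.lookup t (Y j)"
      using that by (auto simp: mdeg_def)
    then show ?thesis
    proof
      assume "k \<le> Poly_Mapping.lookup t (X i) + Poly_Mapping.lookup t (X j)"
      with that ij t show ?thesis
        by (intro monom_mem_by_exchange[OF I v rel[OF e]]) (auto simp: mdeg_def)
    next
      have r: "var (Y i) * var (X j) - var (Y j) * var (X i) \<in> ?I"
        using rel[OF e'] by (simp add: mult.commute)
      assume "k \<le> Poly_Mapping.lookup t (Y i) + Poly_Mapping.lookup t (Y j)"
      with that ij t show ?thesis
        by (intro monom_mem_by_exchange[OF I v r]) (auto simp: mdeg_def)
    qed
  qed
  have e': "{j, i} \<in> E" and d': "2 * (k - 1) < mdeg t j + mdeg t i"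
    using e d by (simp_all add: insert_commute)
  have "k \<le> mdeg t i \<or> k \<le> mdeg t j" using d by auto
  then show ?thesis
    using main[OF e _ d] main[OF e' _ d'] by blast
qed

section \<open>Summing edge bounds over a 2-factor\<close>

text \<open>Each vertex of the cycle starts exactly one of its edges and ends exactly one, since the
  cyclic successor permutes the positions. Adding the edge bounds therefore counts every
  \<open>d i\<close> twice.\<close>

lemma sum_cycle_le:
  fixes d :: "nat \<Rightarrow> nat"
  assumes c: "is_cycle E c" and d: "\<And>i j. {i, j} \<in> E \<Longrightarrow> d i + d j \<le> 2 * m"
  shows "(\<Sum>i\<in>set c. d i) \<le> (\<Sum>i\<in>set c. m)"
proof -
  let ?l = "length c" and ?s = "\<lambda>i. Suc i mod length c"
  have len: "0 < ?l" and dist: "distinct c" using c by (auto simp: is_cycle_def)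
  have bij: "bij_betw ((!) c) {..<?l} (set c)"
    using bij_betw_nth[OF dist] by auto
  have sum: "(\<Sum>i\<in>set c. d i) = (\<Sum>i<?l. d (c ! i))"
    using sum.reindex_bij_betw[OF bij, of d] by simp
  have "inj_on ?s {..<?l}"
    by (rule inj_onI) (auto simp: mod_Suc split: if_splits)
  then have "bij_betw ?s {..<?l} {..<?l}"
    using len by (intro bij_betw_imageI endo_inj_surj) auto
  then have shift: "(\<Sum>i<?l. d (c ! ?s i)) = (\<Sum>i<?l. d (c ! i))"
    by (rule sum.reindex_bij_betw)
  have "2 * (\<Sum>i<?l. d (c ! i)) = (\<Sum>i<?l. d (c ! i) + d (c ! ?s i))"
    by (simp add: sum.distrib shift)
  also have "\<dots> \<le> (\<Sum>i<?l. 2 * m)"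
    using c by (intro sum_mono d) (auto simp: is_cycle_def)
  finally show ?thesis
    using sum dist by (simp add: distinct_card)
qed

lemma sum_two_factor_le:
  fixes d :: "nat \<Rightarrow> nat"
  assumes "has_two_factor n E" and d: "\<And>i j. {i, j} \<in> E \<Longrightarrow> d i + d j \<le> 2 * m"
  shows "(\<Sum>i=1..n. d i) \<le> n * m"
proof -
  obtain C where C: "\<forall>c\<in>C. is_cycle E c"
    and disj: "\<forall>a\<in>C. \<forall>b\<in>C. a \<noteq> b \<longrightarrow> set a \<inter> set b = {}"
    and cover: "(\<Union>c\<in>C. set c) = {1..n}"
    using assms(1) unfolding has_two_factor_def by (elim exE conjE)
  \<comment> \<open>This serves to derive finiteness of \<open>C\<close>: the vertex sets are
    nonempty and disjoint for distinct cycles, so \<open>set\<close> is injective on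
    \<open>C\<close>, and they form a finite family because their union is finite.\<close>
  have "inj_on set C"
  proof (rule inj_onI, rule ccontr)
    fix a b assume ab: "a \<in> C" "b \<in> C" "set a = set b" "a \<noteq> b"
    have "set a \<inter> set b = {}" using disj ab(1,2,4) by simp
    with ab(3) have "a = []" by simp
    then show False using bspec[OF C ab(1)] by (simp add: is_cycle_def)
  qed
  moreover have "finite (set ` C)"
    by (rule finite_UnionD) (simp add: cover)
  ultimately have fin: "finite C" by (rule finite_imageD[rotated])
  have split: "(\<Sum>i=1..n. f i) = (\<Sum>c\<in>C. \<Sum>i\<in>set c. f i)" for f :: "nat \<Rightarrow> nat"
    unfolding cover[symmetric] using fin disj by (intro sum.UNION_disjoint) auto
  have "(\<Sum>i=1..n. d i) \<le> (\<Sum>i=1..n. m)"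
    unfolding split by (intro sum_mono sum_cycle_le[OF bspec[OF C]] d)
  then show ?thesis by simp
qed

section \<open>Powers of the maximal ideal and the upper bound\<close>

lemma ideals_set_pow:
  "\<one>\<^bsub>ideals_set R\<^esub> = carrier R"
  "I \<otimes>\<^bsub>ideals_set R\<^esub> J = I \<cdot>\<^bsub>R\<^esub> J"
  "I [^]\<^bsub>ideals_set R\<^esub> (0::nat) = carrier R"
  "I [^]\<^bsub>ideals_set R\<^esub> Suc r = (I [^]\<^bsub>ideals_set R\<^esub> r) \<cdot>\<^bsub>R\<^esub> I"
  by (simp_all add: nat_pow_def ideals_set_def)

text \<open>An ideal containing the \<open>r\<close>-th power of \<open>max_ideal n\<close> whose
  membership can be tested one monomial at a time.\<close>

definition degree_ge :: "nat \<Rightarrow> nat \<Rightarrow> 'a::field xy_poly set" where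
  "degree_ge n r = {p \<in> carrier (xy_ring n). \<forall>t\<in>Poly_Mapping.keys p. r \<le> (\<Sum>i=1..n. mdeg t i)}"

lemma degree_ge_mult:
  assumes "p \<in> degree_ge n r" "q \<in> degree_ge n s"
  shows "p * q \<in> degree_ge n (r + s)"
  unfolding degree_ge_def
proof (intro CollectI conjI ballI)
  show "p * q \<in> carrier (xy_ring n)"
    using assms by (auto simp: degree_ge_def intro: xy_ring_mult_closed)
next
  fix t assume "t \<in> Poly_Mapping.keys (p * q)"
  then obtain a b where "a \<in> Poly_Mapping.keys p" "b \<in> Poly_Mapping.keys q" "t = a + b"
    using keys_mult[of p q] by blast
  with assms show "r + s \<le> (\<Sum>i=1..n. mdeg t i)"
    by (auto simp: degree_ge_def mdeg_add sum.distrib intro: add_mono)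
qed

lemma degree_ge_add:
  "p \<in> degree_ge n r \<Longrightarrow> q \<in> degree_ge n r \<Longrightarrow> p + q \<in> degree_ge n r"
  using Poly_Mapping.keys_add[of p q] by (auto simp: degree_ge_def intro: xy_ring_add_closed)

lemma degree_ge_ideal: "ideal (degree_ge n r :: 'a::field xy_poly set) (xy_ring n)"
proof (rule xy_idealI)
  fix p :: "'a xy_poly" and s :: "indet \<Rightarrow>\<^sub>0 nat" and c :: 'a
  assume "p \<in> degree_ge n r" "Poly_Mapping.keys s \<subseteq> indets n"
  moreover from this have "Poly_Mapping.single s c \<in> degree_ge n 0"
    by (simp only: degree_ge_def mem_Collect_eq xy_ring_single_closed) simp
  ultimately show "Poly_Mapping.single s c * p \<in> degree_ge n r"
    using degree_ge_mult[of "Poly_Mapping.single s c" n 0 p r] by simp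
next
  show "p + q \<in> degree_ge n r" if "p \<in> degree_ge n r" "q \<in> degree_ge n r" for p q :: "'a xy_poly"
    using that by (rule degree_ge_add)
qed (auto simp: degree_ge_def mem_xy_ring_iff)

lemma max_ideal_pow_subset:
  "(max_ideal n :: 'a::field xy_poly set) [^]\<^bsub>ideals_set (xy_ring n)\<^esub> r \<subseteq> degree_ge n r"
proof (induction r)
  case 0
  show ?case by (auto simp: ideals_set_pow degree_ge_def)
next
  case (Suc r)
  interpret cring "xy_ring n :: 'a xy_poly ring" by (rule xy_ring_cring)
  have "(var v :: 'a xy_poly) \<in> degree_ge n 1" if "v \<in> indets n" for v
    using that var_closed[OF that, where ?'a='a]
    by (auto simp: degree_ge_def var_def mdeg_single)
  then have "(max_ideal n :: 'a xy_poly set) \<subseteq> degree_ge n 1"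
    unfolding max_ideal_def by (intro genideal_minimal degree_ge_ideal) blast
  \<comment> \<open>Induction over the sums of products that make up an ideal product: degrees add
    in each product, and sums preserve the lower bound.\<close>
  moreover have "p \<in> degree_ge n (Suc r)"
    if "p \<in> I \<cdot>\<^bsub>xy_ring n\<^esub> J" "I \<subseteq> degree_ge n r" "J \<subseteq> degree_ge n 1" for p :: "'a xy_poly" and I J
    using that(1)
  proof induction
    case (prod i j)
    then show ?case using that degree_ge_mult[of i n r j 1] by auto
  qed (simp add: degree_ge_add)
  ultimately show ?case
    using Suc by (auto simp: ideals_set_pow)
qed

lemma max_ideal_pow_subset_frob_edge_ideal:
  assumes G: "simple_graph n E" and F: "has_two_factor n E" and r: "n * (k - 1) < r"
  shows "(max_ideal n :: 'a::field xy_poly set) [^]\<^bsub>ideals_set (xy_ring n)\<^esub> r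
      \<subseteq> frob_edge_ideal n E k" (is "_ \<subseteq> ?I")
proof
  note I = frob_edge_ideal[OF G, of k, where ?'a='a]
  fix p :: "'a xy_poly"
  assume "p \<in> max_ideal n [^]\<^bsub>ideals_set (xy_ring n)\<^esub> r"
  then have p: "p \<in> degree_ge n r" using max_ideal_pow_subset by blast
  have "Poly_Mapping.single t (Poly_Mapping.lookup p t) \<in> ?I" if t: "t \<in> Poly_Mapping.keys p" for t
  proof -
    have kt: "Poly_Mapping.keys t \<subseteq> indets n" and "r \<le> (\<Sum>i=1..n. mdeg t i)"
      using p t by (auto simp: degree_ge_def mem_xy_ring_iff)
    \<comment> \<open>The contrapositive of the 2-factor bound with \<open>d = mdeg t\<close> and
      \<open>m = k - 1\<close> yields an edge whose ends are too heavy.\<close>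
    with r have "\<not> (\<Sum>i=1..n. mdeg t i) \<le> n * (k - 1)" by linarith
    then obtain i j where "{i, j} \<in> E" "2 * (k - 1) < mdeg t i + mdeg t j"
      using sum_two_factor_le[OF F, of "mdeg t" "k - 1"] by (meson not_le)
    then have "xy_monom t \<in> ?I" by (rule edge_monom_mem[OF G _ kt])
    then have "Poly_Mapping.single 0 (Poly_Mapping.lookup p t) * xy_monom t \<in> ?I"
      by (rule xy_ideal_mult[OF I]) (simp add: xy_ring_single_closed)
    then show ?thesis by (simp add: mult_single)
  qed
  then show "p \<in> ?I"
    by (subst poly_mapping_eq_sum_single) (rule xy_ideal_sum[OF I])
qed

section \<open>The substitution into one variable per vertex and the lower bound\<close>

text \<open>The coefficient of \<open>z\<^sup>e\<close> in the image of \<open>p\<close> under \<open>x\<^sub>i, y\<^sub>i \<mapsto> z\<^sub>i\<close>.\<close>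

definition mcoeff :: "(nat \<Rightarrow> nat) \<Rightarrow> 'a::field xy_poly \<Rightarrow> 'a" where
  "mcoeff e p = (\<Sum>t\<in>Poly_Mapping.keys p. if mdeg t = e then Poly_Mapping.lookup p t else 0)"

text \<open>Indices outside the keys contribute zero. This lets the sums for several polynomials run
  over one common finite set.\<close>

lemma mcoeff_superset:
  assumes "finite A" "Poly_Mapping.keys p \<subseteq> A"
  shows "mcoeff e p = (\<Sum>t\<in>A. if mdeg t = e then Poly_Mapping.lookup p t else 0)"
  unfolding mcoeff_def using assms
  by (intro sum.mono_neutral_left) (auto simp: in_keys_iff)

lemma mcoeff_add: "mcoeff e (p + q) = mcoeff e p + mcoeff e q"
proof -
  let ?A = "Poly_Mapping.keys p \<union> Poly_Mapping.keys q"
  show ?thesis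
    using mcoeff_superset[of ?A p e] mcoeff_superset[of ?A q e] mcoeff_superset[of ?A "p + q" e]
      Poly_Mapping.keys_add[of p q]
    by (auto simp: lookup_add sum.distrib[symmetric] intro!: sum.cong)
qed

lemma mcoeff_single: "mcoeff e (Poly_Mapping.single t c) = (if mdeg t = e then c else 0)"
  using mcoeff_superset[of "{t}" "Poly_Mapping.single t c" e] by simp

lemma lookup_single_mult_add:
  "Poly_Mapping.lookup (Poly_Mapping.single s c * p) (s + u) = c * Poly_Mapping.lookup p u"
  for p :: "'a::field xy_poly"
proof -
  have "Poly_Mapping.single s c * p =
      (\<Sum>t\<in>Poly_Mapping.keys p. Poly_Mapping.single (s + t) (c * Poly_Mapping.lookup p t))"
    by (subst poly_mapping_eq_sum_single[of p]) (simp add: sum_distrib_left mult_single)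
  then show ?thesis
    by (auto simp: lookup_sum lookup_single when_def in_keys_iff)
qed

text \<open>Multiplication by a term shifts all multidegrees by \<open>mdeg s\<close>. The case
  distinction guards the truncated subtraction: multidegrees not above \<open>mdeg s\<close> are
  never reached.\<close>

lemma mcoeff_single_mult:
  "mcoeff e (Poly_Mapping.single s c * p) =
    (if mdeg s \<le> e then c * mcoeff (\<lambda>i. e i - mdeg s i) p else 0)"
proof -
  let ?A = "(+) s ` Poly_Mapping.keys p"
  have "Poly_Mapping.keys (Poly_Mapping.single s c * p) \<subseteq> ?A"
    using keys_mult[of "Poly_Mapping.single s c" p] by (auto split: if_splits)
  then have "mcoeff e (Poly_Mapping.single s c * p) =
      (\<Sum>t\<in>?A. if mdeg t = e then Poly_Mapping.lookup (Poly_Mapping.single s c * p) t else 0)"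
    by (intro mcoeff_superset) auto
  also have "\<dots> = (\<Sum>u\<in>Poly_Mapping.keys p. if mdeg (s + u) = e then c * Poly_Mapping.lookup p u else 0)"
    by (subst sum.reindex) (auto simp: lookup_single_mult_add cong: if_cong)
  also have "\<dots> = (\<Sum>u\<in>Poly_Mapping.keys p. if mdeg s \<le> e \<and> mdeg u = (\<lambda>i. e i - mdeg s i)
      then c * Poly_Mapping.lookup p u else 0)"
  proof -
    have "mdeg (s + u) = e \<longleftrightarrow> mdeg s \<le> e \<and> mdeg u = (\<lambda>i. e i - mdeg s i)" for u
      unfolding fun_eq_iff le_fun_def mdeg_add by (metis add_diff_cancel_left' le_add1 le_add_diff_inverse)
    then show ?thesis by simp
  qed
  finally show ?thesis
    by (auto simp: mcoeff_def sum_distrib_left intro!: sum.cong)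
qed

text \<open>The preimage of the monomial ideal generated by the k-th powers of z_1, ..., z_n under
  the substitution: only monomials with some exponent at least \<open>k\<close> survive in the
  image.\<close>

definition mcoeff_kernel :: "nat \<Rightarrow> nat \<Rightarrow> 'a::field xy_poly set" where
  "mcoeff_kernel n k = {p \<in> carrier (xy_ring n). \<forall>e. (\<forall>i\<in>{1..n}. e i < k) \<longrightarrow> mcoeff e p = 0}"

lemma mcoeff_kernel_ideal: "ideal (mcoeff_kernel n k :: 'a::field xy_poly set) (xy_ring n)"
proof (rule xy_idealI)
  fix p :: "'a xy_poly" and s :: "indet \<Rightarrow>\<^sub>0 nat" and c :: 'a
  assume p: "p \<in> mcoeff_kernel n k" and s: "Poly_Mapping.keys s \<subseteq> indets n"
  have "Poly_Mapping.single s c * p \<in> carrier (xy_ring n)"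
    using p by (intro xy_ring_mult_closed xy_ring_single_closed[OF s]) (simp add: mcoeff_kernel_def)
  \<comment> \<open>Lowering the exponents keeps them all below \<open>k\<close>, so the defining
    condition for \<open>p\<close> applies.\<close>
  moreover have "mcoeff (\<lambda>i. e i - mdeg s i) p = 0" if "\<forall>i\<in>{1..n}. e i < k" for e
    using p that by (auto simp: mcoeff_kernel_def less_imp_diff_less)
  ultimately show "Poly_Mapping.single s c * p \<in> mcoeff_kernel n k"
    by (simp add: mcoeff_kernel_def mcoeff_single_mult)
next
  show "0 \<in> (mcoeff_kernel n k :: 'a xy_poly set)"
    by (simp add: mcoeff_kernel_def mcoeff_def mem_xy_ring_iff)
qed (auto simp: mcoeff_kernel_def mcoeff_add xy_ring_add_closed)

lemma frob_edge_ideal_subset_kernel: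
  assumes G: "simple_graph n E"
  shows "frob_edge_ideal n E k
      \<subseteq> (mcoeff_kernel n k :: 'a::field xy_poly set)"
proof -
  interpret cring "xy_ring n :: 'a xy_poly ring" by (rule xy_ring_cring)
  have "(var v :: 'a xy_poly) ^ k \<in> mcoeff_kernel n k" if v: "v \<in> indets n" for v
  proof -
    \<comment> \<open>The image of \<open>var v ^ k\<close> is a k-th power, whose exponent at the
      index of \<open>v\<close> is exactly \<open>k\<close>.\<close>
    have "mdeg (Poly_Mapping.single v k) \<noteq> e" if "\<forall>i\<in>{1..n}. e i < k" for e
      using v that by (auto simp: mdeg_single)
    then show ?thesis
      using xy_ring_power_closed[OF var_closed[OF v], of k, where ?'a='a]
      by (auto simp: mcoeff_kernel_def mcoeff_single var_power)
  qed
  then have B: "(bracket_power n k :: 'a xy_poly set) \<subseteq> mcoeff_kernel n k"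
    unfolding bracket_power_def by (intro genideal_minimal mcoeff_kernel_ideal) blast
  have "var (X i) * var (Y j) - var (X j) * var (Y i) \<in> (mcoeff_kernel n k :: 'a xy_poly set)"
    if e: "{i, j} \<in> E" for i j
  proof -
    have eq: "(var (X i) * var (Y j) - var (X j) * var (Y i) :: 'a xy_poly) =
        xy_monom (Poly_Mapping.single (X i) 1 + Poly_Mapping.single (Y j) 1)
        + Poly_Mapping.single (Poly_Mapping.single (X j) 1 + Poly_Mapping.single (Y i) 1) (-1)"
      by (simp add: var_def mult_single single_uminus)
    \<comment> \<open>Both terms map to the same monomial z_i z_j, so their coefficients 1 and -1
      cancel.\<close>
    have "mdeg (Poly_Mapping.single (X i) 1 + Poly_Mapping.single (Y j) 1) =
        mdeg (Poly_Mapping.single (X j) 1 + Poly_Mapping.single (Y i) 1)"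
      by (auto simp: fun_eq_iff mdeg_add mdeg_single)
    then have "mcoeff f (var (X i) * var (Y j) - var (X j) * var (Y i) :: 'a xy_poly) = 0" for f
      unfolding eq mcoeff_add mcoeff_single by simp
    moreover have "(var (X i) * var (Y j) - var (X j) * var (Y i) :: 'a xy_poly) \<in> carrier (xy_ring n)"
      using edge_generators_closed[OF G, where ?'a='a] e by blast
    ultimately show ?thesis by (simp add: mcoeff_kernel_def)
  qed
  then have "(binomial_edge_ideal n E :: 'a xy_poly set) \<subseteq> mcoeff_kernel n k"
    unfolding binomial_edge_ideal_def by (intro genideal_minimal mcoeff_kernel_ideal) blast
  with B show ?thesis
    by (auto simp: set_add_def' intro!: xy_ideal_add[OF mcoeff_kernel_ideal])
qed

lemma mult_power_mem_max_ideal_pow: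
  assumes "p \<in> (max_ideal n :: 'a::field xy_poly set) [^]\<^bsub>ideals_set (xy_ring n)\<^esub> r" "v \<in> indets n"
  shows "p * var v ^ m \<in> max_ideal n [^]\<^bsub>ideals_set (xy_ring n)\<^esub> (r + m)"
proof (induction m)
  case 0
  show ?case using assms by simp
next
  case (Suc m)
  interpret cring "xy_ring n :: 'a xy_poly ring" by (rule xy_ring_cring)
  have "{var v | v. v \<in> indets n} \<subseteq> carrier (xy_ring n :: 'a xy_poly ring)"
    using var_closed by blast
  then have "(var v :: 'a xy_poly) \<in> max_ideal n"
    unfolding max_ideal_def using assms(2) genideal_self by blast
  from ideal_prod.prod[OF Suc this, of "xy_ring n"] show ?case
    by (simp add: ideals_set_pow mult_ac)
qed

lemma max_ideal_pow_not_subset: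
  assumes G: "simple_graph n E" and k: "1 \<le> k"
  shows "\<not> (max_ideal n :: 'a::field xy_poly set) [^]\<^bsub>ideals_set (xy_ring n)\<^esub> (n * (k - 1))
      \<subseteq> frob_edge_ideal n E k"
proof -
  \<comment> \<open>The exponent vector of the product of the \<open>X i ^ (k - 1)\<close> for
    \<open>i\<close> up to \<open>N\<close>; the partial products allow an induction that adds one
    vertex at a time.\<close>
  define t where "t N = (\<Sum>i=1..N. Poly_Mapping.single (X i) (k - 1))" for N :: nat
  have mdeg: "mdeg (t N) i = (if i \<in> {1..N} then k - 1 else 0)" for N i
    by (induction N) (auto simp: t_def mdeg_add mdeg_single, simp add: mdeg_def)
  have "(xy_monom (t N) :: 'a xy_poly) \<in> max_ideal n [^]\<^bsub>ideals_set (xy_ring n)\<^esub> (N * (k - 1))"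
    if "N \<le> n" for N
    using that
  proof (induction N)
    case 0
    show ?case by (simp add: t_def ideals_set_pow mem_xy_ring_iff)
  next
    case (Suc N)
    have "(xy_monom (t (Suc N)) :: 'a xy_poly) = xy_monom (t N) * var (X (Suc N)) ^ (k - 1)"
      by (simp add: t_def var_power mult_single)
    then show ?case
      using mult_power_mem_max_ideal_pow[of "xy_monom (t N)" n "N * (k - 1)" "X (Suc N)" "k - 1"] Suc
      by (simp add: add.commute)
  qed
  then have "(xy_monom (t n) :: 'a xy_poly) \<in> max_ideal n [^]\<^bsub>ideals_set (xy_ring n)\<^esub> (n * (k - 1))"
    by simp
  \<comment> \<open>The witness is its own multidegree: the coefficient there is 1, and all entries
    on \<open>{1..n}\<close> are \<open>k - 1\<close>, which is below \<open>k\<close> because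
    \<open>k\<close> is positive.\<close>
  moreover have "(xy_monom (t n) :: 'a xy_poly) \<notin> mcoeff_kernel n k"
    using k by (auto simp: mcoeff_kernel_def mcoeff_single mdeg intro!: exI[of _ "mdeg (t n)"])
  ultimately show ?thesis
    using frob_edge_ideal_subset_kernel[OF G, of k, where ?'a='a] by blast
qed

section \<open>The exact value for each \<open>k\<close> and the limit\<close>

lemma v_number_two_factor:
  assumes "simple_graph n E" "has_two_factor n E" "1 \<le> k"
  shows "v_number TYPE('a::field) n E k = n * (k - 1)"
  unfolding v_number_def
proof (rule Max_eqI)
  let ?R = "{r. \<not> (max_ideal n :: 'a xy_poly set) [^]\<^bsub>ideals_set (xy_ring n)\<^esub> r
     \<subseteq> frob_edge_ideal n E k} :: nat set"
  show le: "r \<le> n * (k - 1)" if "r \<in> ?R" for r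
    using max_ideal_pow_subset_frob_edge_ideal[OF assms(1,2), of k r, where ?'a='a] that
    by (meson mem_Collect_eq not_le)
  \<comment> \<open>The upper bound also supplies the finiteness on which \<open>Max\<close>
    depends.\<close>
  show "finite ?R"
    by (rule rev_finite_subset[OF finite_atMost[of "n * (k - 1)"]]) (use le in auto)
  show "n * (k - 1) \<in> ?R"
    using max_ideal_pow_not_subset[OF assms(1,3)] by simp
qed

theorem theorem5p7:
  fixes n :: nat and E :: "nat set set"
  assumes "simple_graph n E"
    and "has_two_factor n E"
  shows "convergent (\<lambda>k. real (v_number TYPE('a::field) n E k) / real k) \<and>
         F_threshold TYPE('a) n E = real n"
proof -
  have "(\<lambda>k. real n - real n * inverse (real k)) \<longlonglongrightarrow> real n - real n * 0"
    by (intro tendsto_intros lim_inverse_n)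
  \<comment> \<open>For positive \<open>k\<close> the quotient is n (k - 1) / k = n - n / k. The
    index \<open>k = 0\<close> is excluded because division by zero returns 0.\<close>
  moreover have "\<forall>\<^sub>F k in sequentially. real n - real n * inverse (real k)
      = real (v_number TYPE('a) n E k) / real k"
    using eventually_ge_at_top[of 1]
    by eventually_elim (simp add: v_number_two_factor[OF assms] field_simps of_nat_diff)
  ultimately have "(\<lambda>k. real (v_number TYPE('a) n E k) / real k) \<longlonglongrightarrow> real n"
    by (simp add: Lim_transform_eventually)
  then show ?thesis
    by (auto simp: F_threshold_def convergent_def limI)
qed

end
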